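(* Let $w:A\to B$ be a horizontal arrow in a weakly globular double category $\mathbb X$. Then $w:\bar A\to\bar B$ is a quasi unit in the fundamental bicategory $\mathbf{Bic}\,\mathbb X$ if and only if $w:A\to B$ has a companion $w_*$ (a vertical arrow from $A$ to $B$) in $\mathbb X$.
   Context: A double category $\mathbb X$ is an internal category in $\mathsf{Cat}$: categories $\mathbb X_0$ (objects and vertical arrows) and $\mathbb X_1$ (horizontal arrows as objects, double cells as arrows; vertical composition is written $\cdot$), functors $d_0,d_1:\mathbb X_1\to\mathbb X_0$ (horizontal domain, codomain), $s$ (horizontal identities) and $m$ (horizontal composition, written $\circ$). Write $\mathrm{Id}_A=s(A)$, $\mathrm{id}_v=s(v)$, $1_A$ for vertical identity arrows, $1_f$ for vertical identity cells. $\mathbb X$ is weakly globular if the quotient functor $\gamma:\mathbb X_0\to\mathbb X_0^d$ onto the discrete category of path components of $\mathbb X_0$ is an equivalence and induces equivalences $\mathbb X_1\times_{\mathbb X_0}\overset{n}{\cdots}\times_{\mathbb X_0}\mathbb X_1\simeq\mathbb X_1\times_{\mathbb X_0^d}\overset{n}{\cdots}\times_{\mathbb X_0^d}\mathbb X_1$ for all $n\ge 2$. A horizontal arrow $f:A\to B$ and a vertical arrow $v$ from $A$ to $B$ are companions if there are double cells $\psi$ (top $\mathrm{Id}_A$, left $1_A$, right $v$, bottom $f$) and $\chi$ (top $f$, left $v$, right $1_B$, bottom $\mathrm{Id}_B$) with $\chi\circ\psi=1_f$ (horizontal composite) and $\chi\cdot\psi=\mathrm{id}_v$ (vertical composite).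 The fundamental bicategory $\mathbf{Bic}\,\mathbb X$ of a weakly globular double category: objects are the path components $\bar A$ of $\mathbb X_0$; 1-cells $\bar A\to\bar B$ are the horizontal arrows $A'\to B'$ of $\mathbb X$ with $\bar A'=\bar A$, $\bar B'=\bar B$; 2-cells $f\Rightarrow g$ are the double cells with vertical domain (top) $f$ and vertical codomain (bottom) $g$, i.e. arrows of $\mathbb X_1$, with vertical composition that of $\mathbb X_1$. Horizontal composition is $m\circ\mu_2$ for a chosen pseudo-inverse $\mu_2$ of $\mathbb X_1\times_{\mathbb X_0}\mathbb X_1\to\mathbb X_1\times_{\mathbb X_0^d}\mathbb X_1$, so the composite of $f:A_1\to B_1$ and $g:B_2\to C_2$ with $\bar B_1=\bar B_2$ is $g_3\circ f_3$ for a chosen horizontally composable pair $(f_3,g_3)$ with vertically invertible double cells $f_3\to f$ and $g_3\to g$. The identity on $\bar A$ is $\mathrm{Id}_{\theta(\bar A)}$ for a chosen object $\theta(\bar A)$ in the component $\bar A$. Associativity and unit isomorphisms are the canonical ones induced by the equivalences above. A quasi unit in a bicategory is an endomorphism $f:A\to A$ admitting an invertible 2-cell $f\cong 1_A$. (So $w$ being a quasi unit includes $\bar A=\bar B$.) *)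

theory Defs
  imports Main
begin

section \<open>Categories, functors, equivalences\<close>

text \<open>
  \<open>Comp C b a\<close> is the composite ``\<open>b\<close> after \<open>a\<close>''.  Values of the operations outside the carriers
  \<open>Ob C\<close> and \<open>Ar C\<close> are irrelevant; accordingly, functors and natural transformations are
  constrained on the carriers only.
\<close>

record ('o, 'a) cat =
  Ob :: "'o set"
  Ar :: "'a set"
  Dom :: "'a \<Rightarrow> 'o"
  Cod :: "'a \<Rightarrow> 'o"
  One :: "'o \<Rightarrow> 'a"
  Comp :: "'a \<Rightarrow> 'a \<Rightarrow> 'a"

definition category :: "('o, 'a) cat \<Rightarrow> bool" where
  "category C \<longleftrightarrow>
    (\<forall>a\<in>Ar C. Dom C a \<in> Ob C \<and> Cod C a \<in> Ob C) \<and>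
    (\<forall>x\<in>Ob C. One C x \<in> Ar C \<and> Dom C (One C x) = x \<and> Cod C (One C x) = x) \<and>
    (\<forall>a\<in>Ar C. \<forall>b\<in>Ar C. Cod C a = Dom C b \<longrightarrow>
      Comp C b a \<in> Ar C \<and> Dom C (Comp C b a) = Dom C a \<and> Cod C (Comp C b a) = Cod C b) \<and>
    (\<forall>a\<in>Ar C. Comp C a (One C (Dom C a)) = a \<and> Comp C (One C (Cod C a)) a = a) \<and>
    (\<forall>a\<in>Ar C. \<forall>b\<in>Ar C. \<forall>c\<in>Ar C. Cod C a = Dom C b \<longrightarrow> Cod C b = Dom C c \<longrightarrow>
      Comp C c (Comp C b a) = Comp C (Comp C c b) a)"

definition inverse_arrows :: "('o, 'a) cat \<Rightarrow> 'a \<Rightarrow> 'a \<Rightarrow> bool" where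
  "inverse_arrows C a b \<longleftrightarrow>
    a \<in> Ar C \<and> b \<in> Ar C \<and> Dom C b = Cod C a \<and> Cod C b = Dom C a \<and>
    Comp C b a = One C (Dom C a) \<and> Comp C a b = One C (Cod C a)"

definition invertible_arr :: "('o, 'a) cat \<Rightarrow> 'a \<Rightarrow> bool" where
  "invertible_arr C a \<longleftrightarrow> (\<exists>b. inverse_arrows C a b)"

definition inv_arr :: "('o, 'a) cat \<Rightarrow> 'a \<Rightarrow> 'a" where
  "inv_arr C a = (THE b. inverse_arrows C a b)"

record ('o, 'a, 'p, 'b) func =
  fob :: "'o \<Rightarrow> 'p"
  far :: "'a \<Rightarrow> 'b"

definition is_functor :: "('o, 'a) cat \<Rightarrow> ('p, 'b) cat \<Rightarrow> ('o, 'a, 'p, 'b) func \<Rightarrow> bool" where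
  "is_functor C D F \<longleftrightarrow>
    (\<forall>x\<in>Ob C. fob F x \<in> Ob D) \<and>
    (\<forall>a\<in>Ar C. far F a \<in> Ar D \<and>
      Dom D (far F a) = fob F (Dom C a) \<and> Cod D (far F a) = fob F (Cod C a)) \<and>
    (\<forall>x\<in>Ob C. far F (One C x) = One D (fob F x)) \<and>
    (\<forall>a\<in>Ar C. \<forall>b\<in>Ar C. Cod C a = Dom C b \<longrightarrow>
      far F (Comp C b a) = Comp D (far F b) (far F a))"

definition id_func :: "('o, 'a, 'o, 'a) func" where
  "id_func = \<lparr>fob = (\<lambda>x. x), far = (\<lambda>a. a)\<rparr>"

definition comp_func ::
  "('p, 'b, 'q, 'c) func \<Rightarrow> ('o, 'a, 'p, 'b) func \<Rightarrow> ('o, 'a, 'q, 'c) func" where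
  "comp_func G F = \<lparr>fob = (\<lambda>x. fob G (fob F x)), far = (\<lambda>a. far G (far F a))\<rparr>"

definition nat_iso ::
  "('o, 'a) cat \<Rightarrow> ('p, 'b) cat \<Rightarrow> ('o, 'a, 'p, 'b) func \<Rightarrow> ('o, 'a, 'p, 'b) func \<Rightarrow>
   ('o \<Rightarrow> 'b) \<Rightarrow> bool" where
  "nat_iso C D F G \<tau> \<longleftrightarrow>
    is_functor C D F \<and> is_functor C D G \<and>
    (\<forall>x\<in>Ob C. invertible_arr D (\<tau> x) \<and> Dom D (\<tau> x) = fob F x \<and> Cod D (\<tau> x) = fob G x) \<and>
    (\<forall>a\<in>Ar C. Comp D (\<tau> (Cod C a)) (far F a) = Comp D (far G a) (\<tau> (Dom C a)))"

definition pseudo_inverse ::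
  "('o, 'a) cat \<Rightarrow> ('p, 'b) cat \<Rightarrow> ('o, 'a, 'p, 'b) func \<Rightarrow> ('p, 'b, 'o, 'a) func \<Rightarrow> bool" where
  "pseudo_inverse C D F G \<longleftrightarrow>
    is_functor C D F \<and> is_functor D C G \<and>
    (\<exists>\<eta>. nat_iso C C id_func (comp_func G F) \<eta>) \<and>
    (\<exists>\<epsilon>. nat_iso D D (comp_func F G) id_func \<epsilon>)"

definition equivalence :: "('o, 'a) cat \<Rightarrow> ('p, 'b) cat \<Rightarrow> ('o, 'a, 'p, 'b) func \<Rightarrow> bool" where
  "equivalence C D F \<longleftrightarrow> (\<exists>G. pseudo_inverse C D F G)"

text \<open>
  The \<open>n\<close>-fold iterated fibre product \<open>C \<times>\<^sub>D \<dots> \<times>\<^sub>D C\<close> (\<open>n \<ge> 1\<close>) along functors \<open>R, L : C \<rightarrow> D\<close>: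
  lists of length \<open>n\<close> in which \<open>R\<close> of each entry equals \<open>L\<close> of the next one.
\<close>

definition chain_list :: "nat \<Rightarrow> 'x set \<Rightarrow> ('x \<Rightarrow> 'y) \<Rightarrow> ('x \<Rightarrow> 'y) \<Rightarrow> 'x list set" where
  "chain_list n S r l =
    {xs. length xs = n \<and> set xs \<subseteq> S \<and> (\<forall>i. Suc i < n \<longrightarrow> r (xs ! i) = l (xs ! Suc i))}"

definition chains ::
  "nat \<Rightarrow> ('o, 'a) cat \<Rightarrow> ('o, 'a, 'p, 'b) func \<Rightarrow> ('o, 'a, 'p, 'b) func \<Rightarrow> ('o list, 'a list) cat"
  where
  "chains n C R L =
    \<lparr>Ob = chain_list n (Ob C) (fob R) (fob L),
     Ar = chain_list n (Ar C) (far R) (far L),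
     Dom = map (Dom C),
     Cod = map (Cod C),
     One = map (One C),
     Comp = map2 (Comp C)\<rparr>"

text \<open>Path components: zigzags of arrows.\<close>

definition component :: "('o, 'a) cat \<Rightarrow> 'o \<Rightarrow> 'o set" where
  "component C x =
    {y. (x, y) \<in> ((\<lambda>a. (Dom C a, Cod C a)) ` Ar C \<union> (\<lambda>a. (Cod C a, Dom C a)) ` Ar C)\<^sup>*}"

definition discrete :: "'x set \<Rightarrow> ('x, 'x) cat" where
  "discrete S =
    \<lparr>Ob = S, Ar = S, Dom = (\<lambda>x. x), Cod = (\<lambda>x. x), One = (\<lambda>x. x), Comp = (\<lambda>y x. x)\<rparr>"


section \<open>Double categories\<close>

text \<open>
  \<open>X0\<close>: objects and vertical arrows; \<open>X1\<close>: horizontal arrows and double cells.  The multiplication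
  \<open>hm\<close> takes a list \<open>[f, g]\<close> (first \<open>f\<close>, then \<open>g\<close>) to the horizontal composite \<open>g \<circ> f\<close>.
\<close>

record ('o, 'v, 'h, 'c) double_cat =
  X0 :: "('o, 'v) cat"
  X1 :: "('h, 'c) cat"
  d0 :: "('h, 'c, 'o, 'v) func"
  d1 :: "('h, 'c, 'o, 'v) func"
  hs :: "('o, 'v, 'h, 'c) func"
  hm :: "('h list, 'c list, 'h, 'c) func"

definition strict_chains :: "('o, 'v, 'h, 'c) double_cat \<Rightarrow> nat \<Rightarrow> ('h list, 'c list) cat" where
  "strict_chains X n = chains n (X1 X) (d1 X) (d0 X)"

definition double_category :: "('o, 'v, 'h, 'c) double_cat \<Rightarrow> bool" where
  "double_category X \<longleftrightarrow>
    category (X0 X) \<and> category (X1 X) \<and>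
    is_functor (X1 X) (X0 X) (d0 X) \<and> is_functor (X1 X) (X0 X) (d1 X) \<and>
    is_functor (X0 X) (X1 X) (hs X) \<and>
    is_functor (strict_chains X 2) (X1 X) (hm X) \<and>
    (\<forall>x\<in>Ob (X0 X). fob (d0 X) (fob (hs X) x) = x \<and> fob (d1 X) (fob (hs X) x) = x) \<and>
    (\<forall>v\<in>Ar (X0 X). far (d0 X) (far (hs X) v) = v \<and> far (d1 X) (far (hs X) v) = v) \<and>
    (\<forall>f g. [f, g] \<in> Ob (strict_chains X 2) \<longrightarrow>
      fob (d0 X) (fob (hm X) [f, g]) = fob (d0 X) f \<and>
      fob (d1 X) (fob (hm X) [f, g]) = fob (d1 X) g) \<and>
    (\<forall>\<alpha> \<beta>. [\<alpha>, \<beta>] \<in> Ar (strict_chains X 2) \<longrightarrow>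
      far (d0 X) (far (hm X) [\<alpha>, \<beta>]) = far (d0 X) \<alpha> \<and>
      far (d1 X) (far (hm X) [\<alpha>, \<beta>]) = far (d1 X) \<beta>) \<and>
    (\<forall>f\<in>Ob (X1 X).
      fob (hm X) [fob (hs X) (fob (d0 X) f), f] = f \<and>
      fob (hm X) [f, fob (hs X) (fob (d1 X) f)] = f) \<and>
    (\<forall>\<alpha>\<in>Ar (X1 X).
      far (hm X) [far (hs X) (far (d0 X) \<alpha>), \<alpha>] = \<alpha> \<and>
      far (hm X) [\<alpha>, far (hs X) (far (d1 X) \<alpha>)] = \<alpha>) \<and>
    (\<forall>f g h. [f, g, h] \<in> Ob (strict_chains X 3) \<longrightarrow>
      fob (hm X) [fob (hm X) [f, g], h] = fob (hm X) [f, fob (hm X) [g, h]]) \<and>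
    (\<forall>\<alpha> \<beta> \<delta>. [\<alpha>, \<beta>, \<delta>] \<in> Ar (strict_chains X 3) \<longrightarrow>
      far (hm X) [far (hm X) [\<alpha>, \<beta>], \<delta>] = far (hm X) [\<alpha>, far (hm X) [\<beta>, \<delta>]])"

definition X0d :: "('o, 'v, 'h, 'c) double_cat \<Rightarrow> ('o set, 'o set) cat" where
  "X0d X = discrete (component (X0 X) ` Ob (X0 X))"

definition gamma :: "('o, 'v, 'h, 'c) double_cat \<Rightarrow> ('o, 'v, 'o set, 'o set) func" where
  "gamma X = \<lparr>fob = component (X0 X), far = (\<lambda>v. component (X0 X) (Dom (X0 X) v))\<rparr>"

definition weak_chains :: "('o, 'v, 'h, 'c) double_cat \<Rightarrow> nat \<Rightarrow> ('h list, 'c list) cat" where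
  "weak_chains X n = chains n (X1 X) (comp_func (gamma X) (d1 X)) (comp_func (gamma X) (d0 X))"

text \<open>
  The functor from strict to weak chains induced by \<open>gamma\<close> does not change the underlying lists,
  hence \<open>id_func\<close> below.
\<close>

definition weakly_globular :: "('o, 'v, 'h, 'c) double_cat \<Rightarrow> bool" where
  "weakly_globular X \<longleftrightarrow>
    double_category X \<and>
    equivalence (X0 X) (X0d X) (gamma X) \<and>
    (\<forall>n\<ge>2. equivalence (strict_chains X n) (weak_chains X n) id_func)"

definition is_cell ::
  "('o, 'v, 'h, 'c) double_cat \<Rightarrow> 'c \<Rightarrow> 'h \<Rightarrow> 'v \<Rightarrow> 'v \<Rightarrow> 'h \<Rightarrow> bool" where
  "is_cell X \<alpha> top_h left_v right_v bottom_h \<longleftrightarrow>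
    \<alpha> \<in> Ar (X1 X) \<and> Dom (X1 X) \<alpha> = top_h \<and> far (d0 X) \<alpha> = left_v \<and>
    far (d1 X) \<alpha> = right_v \<and> Cod (X1 X) \<alpha> = bottom_h"

definition companions :: "('o, 'v, 'h, 'c) double_cat \<Rightarrow> 'o \<Rightarrow> 'o \<Rightarrow> 'h \<Rightarrow> 'v \<Rightarrow> bool" where
  "companions X A B f v \<longleftrightarrow>
    f \<in> Ob (X1 X) \<and> fob (d0 X) f = A \<and> fob (d1 X) f = B \<and>
    v \<in> Ar (X0 X) \<and> Dom (X0 X) v = A \<and> Cod (X0 X) v = B \<and>
    (\<exists>\<psi> \<chi>. is_cell X \<psi> (fob (hs X) A) (One (X0 X) A) v f \<and>
      is_cell X \<chi> f v (One (X0 X) B) (fob (hs X) B) \<and>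
      far (hm X) [\<psi>, \<chi>] = One (X1 X) f \<and>
      Comp (X1 X) \<chi> \<psi> = far (hs X) v)"


section \<open>Bicategories and quasi units\<close>

text \<open>
  The data of a bicategory.  \<open>bcomp1 B g f\<close> and \<open>bcomp2 B \<beta> \<alpha>\<close> are the horizontal composites
  \<open>g f\<close> and \<open>\<beta> \<alpha>\<close>; \<open>bassoc B h g f : (h g) f \<Rightarrow> h (g f)\<close>, \<open>blunit B f : 1 f \<Rightarrow> f\<close>,
  \<open>brunit B f : f 1 \<Rightarrow> f\<close>.
\<close>

record ('x, 'f, 'a) bicat =
  bob :: "'x set"
  bhom :: "'x \<Rightarrow> 'x \<Rightarrow> ('f, 'a) cat"
  bunit :: "'x \<Rightarrow> 'f"
  bcomp1 :: "'f \<Rightarrow> 'f \<Rightarrow> 'f"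
  bcomp2 :: "'a \<Rightarrow> 'a \<Rightarrow> 'a"
  bassoc :: "'f \<Rightarrow> 'f \<Rightarrow> 'f \<Rightarrow> 'a"
  blunit :: "'f \<Rightarrow> 'a"
  brunit :: "'f \<Rightarrow> 'a"

definition quasi_unit :: "('x, 'f, 'a) bicat \<Rightarrow> 'x \<Rightarrow> 'x \<Rightarrow> 'f \<Rightarrow> bool" where
  "quasi_unit B x y f \<longleftrightarrow>
    x \<in> bob B \<and> y = x \<and> f \<in> Ob (bhom B x x) \<and>
    (\<exists>\<alpha>. invertible_arr (bhom B x x) \<alpha> \<and>
      Dom (bhom B x x) \<alpha> = f \<and> Cod (bhom B x x) \<alpha> = bunit B x)"


section \<open>The fundamental bicategory\<close>

text \<open>
  The choices entering the construction: a pseudo-inverse \<open>theta\<close> of \<open>gamma\<close> with a natural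
  isomorphism \<open>theta_unit : 1 \<Rightarrow> theta gamma\<close>, and pseudo-inverses \<open>mu n\<close> of the comparison from
  strict to weak chains with natural isomorphisms \<open>mu_counit n\<close> from \<open>mu n\<close> (read as a functor
  into weak chains) to the identity.  Only \<open>n = 2\<close> and \<open>n = 3\<close> are used.
\<close>

record ('o, 'v, 'h, 'c) bic_choice =
  theta :: "('o set, 'o set, 'o, 'v) func"
  theta_unit :: "'o \<Rightarrow> 'v"
  mu :: "nat \<Rightarrow> ('h list, 'c list, 'h list, 'c list) func"
  mu_counit :: "nat \<Rightarrow> 'h list \<Rightarrow> 'c list"

definition is_bic_choice ::
  "('o, 'v, 'h, 'c) double_cat \<Rightarrow> ('o, 'v, 'h, 'c) bic_choice \<Rightarrow> bool" where
  "is_bic_choice X ch \<longleftrightarrow>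
    pseudo_inverse (X0 X) (X0d X) (gamma X) (theta ch) \<and>
    nat_iso (X0 X) (X0 X) id_func (comp_func (theta ch) (gamma X)) (theta_unit ch) \<and>
    (\<forall>n\<in>{2, 3}.
      pseudo_inverse (strict_chains X n) (weak_chains X n) id_func (mu ch n) \<and>
      nat_iso (weak_chains X n) (weak_chains X n) (comp_func id_func (mu ch n)) id_func
        (mu_counit ch n))"

text \<open>
  For a strictly composable pair \<open>p, q\<close> and vertically invertible cells \<open>\<alpha> : p \<rightarrow> f\<close>,
  \<open>\<beta> : q \<rightarrow> g\<close> with \<open>f, g\<close> weakly composable, the canonical cell from \<open>q \<circ> p\<close> to the composite
  of \<open>g\<close> and \<open>f\<close> in the fundamental bicategory.  The composites with the inverse counit components
  form a strictly composable pair of cells, since parallel vertical arrows are equal.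
\<close>

definition comparison_cell ::
  "('o, 'v, 'h, 'c) double_cat \<Rightarrow> ('o, 'v, 'h, 'c) bic_choice \<Rightarrow> 'c \<Rightarrow> 'c \<Rightarrow> 'c" where
  "comparison_cell X ch \<alpha> \<beta> =
    (let \<epsilon> = mu_counit ch 2 [Cod (X1 X) \<alpha>, Cod (X1 X) \<beta>] in
     far (hm X) [Comp (X1 X) (inv_arr (X1 X) (\<epsilon> ! 0)) \<alpha>, Comp (X1 X) (inv_arr (X1 X) (\<epsilon> ! 1)) \<beta>])"

text \<open>
  The associator compares both bracketings with the strict composite \<open>h' \<circ> g' \<circ> f'\<close> of
  \<open>mu 3 [f, g, h] = [f', g', h']\<close>.  The unitors are the inverses of the canonical cells from
  \<open>Id \<circ> f = f\<close> and \<open>f \<circ> Id = f\<close>, with the strict identities at the ends of \<open>f\<close> moved along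
  \<open>theta_unit\<close>.
\<close>

definition Bic ::
  "('o, 'v, 'h, 'c) double_cat \<Rightarrow> ('o, 'v, 'h, 'c) bic_choice \<Rightarrow> ('o set, 'h, 'c) bicat" where
  "Bic X ch =
    \<lparr>bob = Ob (X0d X),
     bhom = (\<lambda>x y.
       let S = {f \<in> Ob (X1 X). fob (gamma X) (fob (d0 X) f) = x \<and> fob (gamma X) (fob (d1 X) f) = y}
       in (X1 X)\<lparr>Ob := S, Ar := {\<alpha> \<in> Ar (X1 X). Dom (X1 X) \<alpha> \<in> S \<and> Cod (X1 X) \<alpha> \<in> S}\<rparr>),
     bunit = (\<lambda>x. fob (hs X) (fob (theta ch) x)),
     bcomp1 = (\<lambda>g f. fob (hm X) (fob (mu ch 2) [f, g])),
     bcomp2 = (\<lambda>\<beta> \<alpha>. far (hm X) (far (mu ch 2) [\<alpha>, \<beta>])),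
     bassoc = (\<lambda>h g f.
       let \<epsilon> = mu_counit ch 3 [f, g, h];
           K = comparison_cell X ch
       in Comp (X1 X) (K (K (\<epsilon> ! 0) (\<epsilon> ! 1)) (\<epsilon> ! 2))
            (inv_arr (X1 X) (K (\<epsilon> ! 0) (K (\<epsilon> ! 1) (\<epsilon> ! 2))))),
     blunit = (\<lambda>f.
       inv_arr (X1 X) (comparison_cell X ch
         (One (X1 X) f) (far (hs X) (theta_unit ch (fob (d1 X) f))))),
     brunit = (\<lambda>f.
       inv_arr (X1 X) (comparison_cell X ch
         (far (hs X) (theta_unit ch (fob (d0 X) f))) (One (X1 X) f)))\<rparr>"

end

theory Submission imports Defs
begin

text \<open>
  Both conditions on \<open>w\<close> amount to the existence of a vertically invertible cell
  \<open>\<chi> : w \<rightarrow> Id\<^sub>B\<close> with right side \<open>1\<^sub>B\<close>.  Given such a \<open>\<chi>\<close> with left side \<open>v\<close>, the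
  cell \<open>\<psi> = \<chi>\<inverse> \<cdot> id\<^sub>v\<close> makes \<open>v\<close> a companion of \<open>w\<close>, as the interchange law turns
  \<open>\<chi> \<circ> \<psi>\<close> into \<open>\<chi>\<inverse> \<cdot> \<chi>\<close>.  Conversely, the cell \<open>\<chi>\<close> of a companion pair has
  the inverse \<open>\<psi> \<cdot> id\<^sub>u\<close>, \<open>u = v\<inverse>\<close>: with \<open>e = \<psi> \<cdot> id\<^sub>u \<cdot> \<chi>\<close> one has \<open>e \<cdot> \<psi> = \<psi>\<close>, so that
  \<open>e = e \<cdot> (\<chi> \<circ> \<psi>) = \<chi> \<circ> (e \<cdot> \<psi>) = \<chi> \<circ> \<psi> = 1\<^sub>w\<close>.  The inverse of \<open>v\<close> exists since \<open>X0\<close> is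
  equivalent to a discrete category, and \<open>Id\<^sub>B\<close> is isomorphic to the identity of the bicategory
  along the vertical isomorphism from \<open>B\<close> to its chosen representative.
\<close>

section \<open>Categories and functors\<close>

lemma category_dom_cod:
  assumes "category C" "a \<in> Ar C"
  shows "Dom C a \<in> Ob C" "Cod C a \<in> Ob C"
  using assms unfolding category_def by blast+

lemma category_one:
  assumes "category C" "x \<in> Ob C"
  shows "One C x \<in> Ar C" "Dom C (One C x) = x" "Cod C (One C x) = x"
  using assms unfolding category_def by blast+

lemma category_comp:
  assumes "category C" "a \<in> Ar C" "b \<in> Ar C" "Cod C a = Dom C b"
  shows "Comp C b a \<in> Ar C" "Dom C (Comp C b a) = Dom C a" "Cod C (Comp C b a) = Cod C b"
  using assms unfolding category_def by blast+

lemma category_unit: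
  assumes "category C" "a \<in> Ar C"
  shows "Comp C a (One C (Dom C a)) = a" "Comp C (One C (Cod C a)) a = a"
  using assms unfolding category_def by blast+

lemma category_assoc:
  assumes "category C" "a \<in> Ar C" "b \<in> Ar C" "c \<in> Ar C" "Cod C a = Dom C b" "Cod C b = Dom C c"
  shows "Comp C c (Comp C b a) = Comp C (Comp C c b) a"
  using assms unfolding category_def by blast

lemma functor_ob: "is_functor C D F \<Longrightarrow> x \<in> Ob C \<Longrightarrow> fob F x \<in> Ob D"
  unfolding is_functor_def by blast

lemma functor_ar:
  assumes "is_functor C D F" "a \<in> Ar C"
  shows "far F a \<in> Ar D" "Dom D (far F a) = fob F (Dom C a)" "Cod D (far F a) = fob F (Cod C a)"
  using assms unfolding is_functor_def by blast+

lemma functor_one: "is_functor C D F \<Longrightarrow> x \<in> Ob C \<Longrightarrow> far F (One C x) = One D (fob F x)"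
  unfolding is_functor_def by blast

lemma functor_comp:
  assumes "is_functor C D F" "a \<in> Ar C" "b \<in> Ar C" "Cod C a = Dom C b"
  shows "far F (Comp C b a) = Comp D (far F b) (far F a)"
  using assms unfolding is_functor_def by blast

section \<open>Mutually inverse arrows and path components\<close>

lemma inverse_arrowsD:
  assumes "inverse_arrows C a b"
  shows "a \<in> Ar C" "b \<in> Ar C" "Dom C b = Cod C a" "Cod C b = Dom C a"
    "Comp C b a = One C (Dom C a)" "Comp C a b = One C (Cod C a)"
  using assms unfolding inverse_arrows_def by blast+

lemma inverse_arrows_sym: "inverse_arrows C a b \<Longrightarrow> inverse_arrows C b a"
  unfolding inverse_arrows_def by simp

lemma inverse_arrows_comp:
  assumes C: "category C" and a: "inverse_arrows C a a'" and b: "inverse_arrows C b b'"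
    and "Cod C a = Dom C b"
  shows "inverse_arrows C (Comp C b a) (Comp C a' b')"
proof -
  note * = inverse_arrowsD[OF a] inverse_arrowsD[OF b] \<open>Cod C a = Dom C b\<close>
  have "Comp C (Comp C a' b') (Comp C b a) = Comp C a' (Comp C (Comp C b' b) a)"
    using * category_assoc[OF C, of "Comp C b a" b' a'] category_assoc[OF C, of a b b']
    by (simp add: category_comp[OF C])
  also have "\<dots> = One C (Dom C a)"
    using * by (metis category_unit(2)[OF C])
  finally have 1: "Comp C (Comp C a' b') (Comp C b a) = One C (Dom C a)" .
  have "Comp C (Comp C b a) (Comp C a' b') = Comp C b (Comp C (Comp C a a') b')"
    using * category_assoc[OF C, of "Comp C a' b'" a b] category_assoc[OF C, of b' a' a]
    by (simp add: category_comp[OF C])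
  also have "\<dots> = One C (Cod C b)"
    using * by (metis category_unit(2)[OF C])
  finally show ?thesis
    using 1 * by (simp add: inverse_arrows_def category_comp[OF C])
qed

lemma functor_inverse_arrows:
  assumes "category C" "is_functor C D F" "inverse_arrows C a b"
  shows "inverse_arrows D (far F a) (far F b)"
proof -
  note * = inverse_arrowsD[OF assms(3)]
  have "Comp D (far F b) (far F a) = One D (fob F (Dom C a))"
       "Comp D (far F a) (far F b) = One D (fob F (Cod C a))"
    using * functor_comp[OF assms(2), of a b] functor_comp[OF assms(2), of b a]
      functor_one[OF assms(2)] category_dom_cod[OF assms(1), of a] by simp_all
  then show ?thesis
    using * by (simp add: inverse_arrows_def functor_ar[OF assms(2)])
qed

text \<open>An inverse runs between the same two objects, so a full subcategory contains it. The
  record update is the shape of the hom-categories of \<open>Bic\<close>.\<close>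

lemma invertible_arr_full_subcategory:
  assumes "Dom C a \<in> S" "Cod C a \<in> S"
  shows "invertible_arr (C\<lparr>Ob := S, Ar := {a \<in> Ar C. Dom C a \<in> S \<and> Cod C a \<in> S}\<rparr>) a
    \<longleftrightarrow> invertible_arr C a"
  using assms by (auto simp: invertible_arr_def inverse_arrows_def)

text \<open>The relation that generates the zigzags is symmetric, so each end of \<open>v\<close>
  reaches whatever the other end reaches.\<close>

lemma component_eq:
  assumes "v \<in> Ar C"
  shows "component C (Dom C v) = component C (Cod C v)"
proof -
  let ?R = "(\<lambda>a. (Dom C a, Cod C a)) ` Ar C \<union> (\<lambda>a. (Cod C a, Dom C a)) ` Ar C"
  have "(Dom C v, Cod C v) \<in> ?R" "(Cod C v, Dom C v) \<in> ?R"
    using assms by auto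
  then have "(Dom C v, z) \<in> ?R\<^sup>* \<longleftrightarrow> (Cod C v, z) \<in> ?R\<^sup>*" for z
    by (meson converse_rtrancl_into_rtrancl)
  then show ?thesis
    unfolding component_def by blast
qed


section \<open>Companions as invertible cells\<close>

lemma double_categoryD:
  assumes "double_category X"
  shows "category (X0 X)" "category (X1 X)"
    "is_functor (X1 X) (X0 X) (d0 X)" "is_functor (X1 X) (X0 X) (d1 X)"
    "is_functor (X0 X) (X1 X) (hs X)" "is_functor (strict_chains X 2) (X1 X) (hm X)"
  using assms unfolding double_category_def by blast+

lemma hs_sides:
  assumes "double_category X"
  shows "x \<in> Ob (X0 X) \<Longrightarrow> fob (d0 X) (fob (hs X) x) = x"
    "x \<in> Ob (X0 X) \<Longrightarrow> fob (d1 X) (fob (hs X) x) = x"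
    "v \<in> Ar (X0 X) \<Longrightarrow> far (d0 X) (far (hs X) v) = v"
    "v \<in> Ar (X0 X) \<Longrightarrow> far (d1 X) (far (hs X) v) = v"
  using assms unfolding double_category_def by blast+

lemma hm_unit:
  assumes "double_category X" "\<alpha> \<in> Ar (X1 X)"
  shows "far (hm X) [far (hs X) (far (d0 X) \<alpha>), \<alpha>] = \<alpha>"
    "far (hm X) [\<alpha>, far (hs X) (far (d1 X) \<alpha>)] = \<alpha>"
  using assms unfolding double_category_def by blast+

text \<open>This is functoriality of \<open>hm\<close>, since composition in
  \<open>strict_chains X 2\<close> is entrywise. The conditions on \<open>d1\<close> and
  \<open>d0\<close> make both pairs strict chains.\<close>

lemma hm_interchange:
  assumes "double_category X"
    and "\<alpha> \<in> Ar (X1 X)" "\<alpha>' \<in> Ar (X1 X)" "\<beta> \<in> Ar (X1 X)" "\<beta>' \<in> Ar (X1 X)"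
    and "Cod (X1 X) \<alpha> = Dom (X1 X) \<alpha>'" "Cod (X1 X) \<beta> = Dom (X1 X) \<beta>'"
    and "far (d1 X) \<alpha> = far (d0 X) \<beta>" "far (d1 X) \<alpha>' = far (d0 X) \<beta>'"
  shows "far (hm X) [Comp (X1 X) \<alpha>' \<alpha>, Comp (X1 X) \<beta>' \<beta>]
    = Comp (X1 X) (far (hm X) [\<alpha>', \<beta>']) (far (hm X) [\<alpha>, \<beta>])"
proof -
  have "[\<alpha>, \<beta>] \<in> Ar (strict_chains X 2)" "[\<alpha>', \<beta>'] \<in> Ar (strict_chains X 2)"
    "Cod (strict_chains X 2) [\<alpha>, \<beta>] = Dom (strict_chains X 2) [\<alpha>', \<beta>']"
    using assms by (simp_all add: strict_chains_def chains_def chain_list_def less_2_cases_iff)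
  from functor_comp[OF double_categoryD(6)[OF assms(1)] this] show ?thesis
    by (simp add: strict_chains_def chains_def)
qed

section \<open>Passage between invertible cells and companion pairs\<close>

lemma companions_of_invertible_cell:
  assumes X: "double_category X"
    and w: "w \<in> Ob (X1 X)" "fob (d0 X) w = A" "fob (d1 X) w = B"
    and \<chi>: "is_cell X \<chi> w v (One (X0 X) B) (fob (hs X) B)"
    and inv: "inverse_arrows (X1 X) \<chi> \<chi>'"
  shows "companions X A B w v"
proof -
  note C0 = double_categoryD(1)[OF X] and C1 = double_categoryD(2)[OF X]
    and F0 = double_categoryD(3)[OF X] and F1 = double_categoryD(4)[OF X]
    and S = double_categoryD(5)[OF X]
  have \<chi>c: "\<chi> \<in> Ar (X1 X)" "Dom (X1 X) \<chi> = w" "far (d0 X) \<chi> = v"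
    "far (d1 X) \<chi> = One (X0 X) B" "Cod (X1 X) \<chi> = fob (hs X) B"
    using \<chi> by (simp_all add: is_cell_def)
  have AB: "A \<in> Ob (X0 X)" "B \<in> Ob (X0 X)"
    using w functor_ob[OF F0] functor_ob[OF F1] by auto
  have v: "v \<in> Ar (X0 X)" "Dom (X0 X) v = A" "Cod (X0 X) v = B"
    using functor_ar[OF F0 \<chi>c(1)] \<chi>c w hs_sides(1)[OF X AB(2)] by auto
  note sv = functor_ar[OF S v(1)] and i = inverse_arrowsD[OF inv]
    and i0 = inverse_arrowsD[OF functor_inverse_arrows[OF C1 F0 inv]]
    and i1 = inverse_arrowsD[OF functor_inverse_arrows[OF C1 F1 inv]]
  have oneB: "One (X0 X) B \<in> Ar (X0 X)" "Dom (X0 X) (One (X0 X) B) = B"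
    "Cod (X0 X) (One (X0 X) B) = B"
    using category_one[OF C0 AB(2)] by auto
  \<comment> \<open>The right side of \<chi>' is inverse to that of \<chi>, which is an
    identity.\<close>
  have d1\<chi>': "far (d1 X) \<chi>' = One (X0 X) B"
    using i1 category_unit(1)[OF C0, of "far (d1 X) \<chi>'"] \<chi>c oneB by simp
  \<comment> \<open>The companion equation \<chi> \<cdot> \<psi> = \<open>id_v\<close> forces this
    choice once \<chi> is invertible.\<close>
  define \<psi> where "\<psi> = Comp (X1 X) \<chi>' (far (hs X) v)"
  have comp: "Cod (X1 X) (far (hs X) v) = Dom (X1 X) \<chi>'"
    using sv i \<chi>c v by simp
  have \<psi>: "is_cell X \<psi> (fob (hs X) A) (One (X0 X) A) v w"
    using category_comp[OF C1 sv(1) i(2) comp] functor_comp[OF F0 sv(1) i(2) comp]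
      functor_comp[OF F1 sv(1) i(2) comp] hs_sides[OF X] v i0 d1\<chi>' \<chi>c sv i
      category_unit(2)[OF C0 v(1)]
    by (simp add: is_cell_def \<psi>_def)
  have vert: "Comp (X1 X) \<chi> \<psi> = far (hs X) v"
    unfolding \<psi>_def
    using category_assoc[OF C1 sv(1) i(2) i(1) comp] i \<chi>c sv v category_unit(2)[OF C1 sv(1)]
    by simp
  \<comment> \<open>This cell serves both as a horizontal unit and as a vertical identity, which
    lets one cell enter the interchange law and the horizontal unit law.\<close>
  have sB: "far (hs X) (One (X0 X) B) = One (X1 X) (fob (hs X) B)"
    using functor_one[OF S AB(2)] .
  have sB': "One (X1 X) (fob (hs X) B) \<in> Ar (X1 X)"
    "Dom (X1 X) (One (X1 X) (fob (hs X) B)) = fob (hs X) B"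
    using category_one[OF C1 functor_ob[OF S AB(2)]] by auto
  have d0sB: "far (d0 X) (One (X1 X) (fob (hs X) B)) = One (X0 X) B"
    using hs_sides(3)[OF X oneB(1)] sB by simp
  \<comment> \<open>Padding \<chi> with a vertical identity makes both entries vertical composites.
    After interchange, each row has a horizontal unit as one factor.\<close>
  have "far (hm X) [\<psi>, \<chi>]
      = far (hm X) [Comp (X1 X) \<chi>' (far (hs X) v), Comp (X1 X) (One (X1 X) (fob (hs X) B)) \<chi>]"
    using category_unit(2)[OF C1 \<chi>c(1)] \<chi>c by (simp add: \<psi>_def)
  also have "\<dots> = Comp (X1 X) (far (hm X) [\<chi>', One (X1 X) (fob (hs X) B)])
      (far (hm X) [far (hs X) v, \<chi>])"
    using hm_interchange[OF X sv(1) i(2) \<chi>c(1) sB'(1) comp] \<chi>c sB' hs_sides(4)[OF X v(1)]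
      d1\<chi>' d0sB by simp
  also have "\<dots> = Comp (X1 X) \<chi>' \<chi>"
    using hm_unit(1)[OF X \<chi>c(1)] hm_unit(2)[OF X i(2)] \<chi>c d1\<chi>' sB by simp
  also have "\<dots> = One (X1 X) w"
    using i \<chi>c by simp
  finally show ?thesis
    using w v \<psi> \<chi> vert unfolding companions_def by blast
qed

text \<open>Vertical arrows of an arbitrary double category may fail to be invertible, so the
  inverse \<open>u\<close> is a hypothesis here; weak globularity supplies it later.\<close>

lemma invertible_cell_of_companions:
  assumes X: "double_category X" and comp: "companions X A B w v"
    and u: "inverse_arrows (X0 X) v u"
  shows "\<exists>\<chi>. is_cell X \<chi> w v (One (X0 X) B) (fob (hs X) B) \<and> invertible_arr (X1 X) \<chi>"
proof -
  note C0 = double_categoryD(1)[OF X] and C1 = double_categoryD(2)[OF X]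
    and F0 = double_categoryD(3)[OF X] and F1 = double_categoryD(4)[OF X]
    and S = double_categoryD(5)[OF X]
  obtain \<psi> \<chi> where \<psi>: "is_cell X \<psi> (fob (hs X) A) (One (X0 X) A) v w"
    and \<chi>: "is_cell X \<chi> w v (One (X0 X) B) (fob (hs X) B)"
    and hor: "far (hm X) [\<psi>, \<chi>] = One (X1 X) w"
    and vert: "Comp (X1 X) \<chi> \<psi> = far (hs X) v"
    using comp unfolding companions_def by blast
  have w: "w \<in> Ob (X1 X)" "fob (d0 X) w = A" "fob (d1 X) w = B"
    and v: "v \<in> Ar (X0 X)" "Dom (X0 X) v = A" "Cod (X0 X) v = B"
    using comp unfolding companions_def by blast+
  have \<chi>c: "\<chi> \<in> Ar (X1 X)" "Dom (X1 X) \<chi> = w" "far (d0 X) \<chi> = v"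
    "far (d1 X) \<chi> = One (X0 X) B" "Cod (X1 X) \<chi> = fob (hs X) B"
    using \<chi> by (simp_all add: is_cell_def)
  have \<psi>c: "\<psi> \<in> Ar (X1 X)" "Dom (X1 X) \<psi> = fob (hs X) A" "far (d0 X) \<psi> = One (X0 X) A"
    "far (d1 X) \<psi> = v" "Cod (X1 X) \<psi> = w"
    using \<psi> by (simp_all add: is_cell_def)
  have AB: "A \<in> Ob (X0 X)" "B \<in> Ob (X0 X)"
    using w functor_ob[OF F0] functor_ob[OF F1] by auto
  note iu = inverse_arrowsD[OF u] and isu = inverse_arrowsD[OF functor_inverse_arrows[OF C0 S u]]
  note sv = functor_ar[OF S v(1)] and su = functor_ar[OF S iu(2)]
  \<comment> \<open>Since \<chi> \<cdot> \<psi> = \<open>id_v\<close>, precomposing with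
    \<open>id_u\<close> yields a right inverse of \<chi>.\<close>
  define \<rho> where "\<rho> = Comp (X1 X) \<psi> (far (hs X) u)"
  have su\<psi>: "Cod (X1 X) (far (hs X) u) = Dom (X1 X) \<psi>"
    using su iu v \<psi>c by simp
  note \<rho>c = category_comp[OF C1 su(1) \<psi>c(1) su\<psi>, folded \<rho>_def]
  have \<rho>dc: "Dom (X1 X) \<rho> = fob (hs X) B" "Cod (X1 X) \<rho> = w"
    using \<rho>c su iu v \<psi>c by auto
  have \<chi>\<rho>: "Comp (X1 X) \<chi> \<rho> = One (X1 X) (fob (hs X) B)"
    using category_assoc[OF C1 su(1) \<psi>c(1) \<chi>c(1) su\<psi>] \<psi>c \<chi>c vert isu sv v
    by (simp add: \<rho>_def)
  \<comment> \<open>The other composite, still to be identified with the vertical identity of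
    \<open>w\<close>.\<close>
  define e where "e = Comp (X1 X) \<rho> \<chi>"
  have \<chi>to\<rho>: "Cod (X1 X) \<chi> = Dom (X1 X) \<rho>"
    using \<chi>c \<rho>dc by simp
  note ec = category_comp[OF C1 \<chi>c(1) \<rho>c(1) \<chi>to\<rho>, folded e_def]
  have e\<psi>: "Comp (X1 X) e \<psi> = \<psi>"
  proof -
    have "Comp (X1 X) e \<psi> = Comp (X1 X) \<rho> (far (hs X) v)"
      using category_assoc[OF C1 \<psi>c(1) \<chi>c(1) \<rho>c(1)] \<psi>c \<chi>c \<chi>to\<rho> vert by (simp add: e_def)
    also have "\<dots> = Comp (X1 X) \<psi> (Comp (X1 X) (far (hs X) u) (far (hs X) v))"
      using category_assoc[OF C1 sv(1) su(1) \<psi>c(1)] su\<psi> su sv iu by (simp add: \<rho>_def)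
    also have "\<dots> = \<psi>"
      using isu sv v \<psi>c category_unit(1)[OF C1 \<psi>c(1)] by simp
    finally show ?thesis .
  qed
  \<comment> \<open>The right sides compose to \<open>v\<close> after \<open>u\<close>, an identity.
    Hence \<open>e\<close> equals its horizontal composite with the unit at
    \<open>B\<close>.\<close>
  have d1e: "far (d1 X) e = One (X0 X) B"
    using functor_comp[OF F1 \<chi>c(1) \<rho>c(1) \<chi>to\<rho>] functor_comp[OF F1 su(1) \<psi>c(1) su\<psi>]
      \<chi>c \<psi>c hs_sides(4)[OF X iu(2)] iu v category_unit(2)[OF C0, of "One (X0 X) B"]
      category_one[OF C0 AB(2)]
    by (simp add: e_def \<rho>_def)
  have sB: "far (hs X) (One (X0 X) B) = One (X1 X) (fob (hs X) B)"
    using functor_one[OF S AB(2)] .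
  have sB': "One (X1 X) (fob (hs X) B) \<in> Ar (X1 X)"
    "Dom (X1 X) (One (X1 X) (fob (hs X) B)) = fob (hs X) B"
    using category_one[OF C1 functor_ob[OF S AB(2)]] by auto
  have d0sB: "far (d0 X) (One (X1 X) (fob (hs X) B)) = One (X0 X) B"
    using hs_sides(3)[OF X] category_one(1)[OF C0 AB(2)] sB by metis
  \<comment> \<open>The identity of \<open>w\<close> is replaced by the horizontal composite of
    \<psi> and \<chi>; interchange then lets \<open>e\<close> act on \<psi> alone, which it
    fixes.\<close>
  have "e = Comp (X1 X) e (far (hm X) [\<psi>, \<chi>])"
    using category_unit(1)[OF C1 ec(1)] ec hor \<chi>c by simp
  also have "\<dots> = Comp (X1 X) (far (hm X) [e, One (X1 X) (fob (hs X) B)]) (far (hm X) [\<psi>, \<chi>])"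
    using hm_unit(2)[OF X ec(1)] d1e sB by simp
  also have "\<dots> = far (hm X) [Comp (X1 X) e \<psi>, Comp (X1 X) (One (X1 X) (fob (hs X) B)) \<chi>]"
    using hm_interchange[OF X \<psi>c(1) ec(1) \<chi>c(1) sB'(1)] ec \<psi>c \<chi>c sB' d1e d0sB by simp
  also have "\<dots> = One (X1 X) w"
    using e\<psi> category_unit(2)[OF C1 \<chi>c(1)] \<chi>c hor by simp
  finally have "inverse_arrows (X1 X) \<chi> \<rho>"
    using \<chi>c \<rho>c(1) \<rho>dc \<chi>\<rho> by (simp add: inverse_arrows_def e_def)
  then show ?thesis
    using \<chi> unfolding invertible_arr_def by blast
qed


section \<open>Quasi units of the fundamental bicategory\<close>

text \<open>In the discrete category the image of \<open>v\<close> is an identity, so naturality of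
  \<eta> at \<open>v\<close> exhibits \<open>v\<close> as the component at its domain followed by
  the inverse of the component at its codomain.\<close>

lemma vertical_arrow_invertible:
  assumes C: "category (X0 X)"
    and G: "is_functor (X0d X) (X0 X) G"
    and \<eta>: "nat_iso (X0 X) (X0 X) id_func (comp_func G (gamma X)) \<eta>"
    and v: "v \<in> Ar (X0 X)"
  shows "invertible_arr (X0 X) v"
proof -
  let ?C = "X0 X" and ?a = "Dom (X0 X) v" and ?b = "Cod (X0 X) v"
  have ab: "?a \<in> Ob ?C" "?b \<in> Ob ?C"
    using category_dom_cod[OF C v] by auto
  have \<eta>x: "invertible_arr ?C (\<eta> x)" "Dom ?C (\<eta> x) = x"
    "Cod ?C (\<eta> x) = fob G (fob (gamma X) x)" if "x \<in> Ob ?C" for x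
    using \<eta> that by (auto simp: nat_iso_def id_func_def comp_func_def)
  obtain p q where p: "inverse_arrows ?C (\<eta> ?a) p" and q: "inverse_arrows ?C (\<eta> ?b) q"
    using \<eta>x(1) ab unfolding invertible_arr_def by blast
  note p' = inverse_arrowsD[OF p] and q' = inverse_arrowsD[OF q]
  have cod: "Cod ?C (\<eta> ?a) = Cod ?C (\<eta> ?b)"
    using \<eta>x(3) ab component_eq[OF v] by (simp add: gamma_def)
  have "fob (gamma X) ?a \<in> Ob (X0d X)" "far (gamma X) v = One (X0d X) (fob (gamma X) ?a)"
    using ab by (simp_all add: gamma_def X0d_def discrete_def)
  then have "far G (far (gamma X) v) = One ?C (Cod ?C (\<eta> ?a))"
    using functor_one[OF G] \<eta>x(3) ab by simp
  moreover have "Comp ?C (\<eta> ?b) v = Comp ?C (far G (far (gamma X) v)) (\<eta> ?a)"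
    using \<eta> v by (simp add: nat_iso_def id_func_def comp_func_def)
  ultimately have nat: "Comp ?C (\<eta> ?b) v = \<eta> ?a"
    using category_unit(2)[OF C p'(1)] by simp
  have "v = Comp ?C q (\<eta> ?a)"
    using category_assoc[OF C v q'(1) q'(2)] q' \<eta>x(2)[OF ab(2)] category_unit(2)[OF C v] nat
    by simp
  then show ?thesis
    using inverse_arrows_comp[OF C p inverse_arrows_sym[OF q]] q' cod
    unfolding invertible_arr_def by auto
qed

theorem proposition6p5:
  fixes X :: "('o, 'v, 'h, 'c) double_cat"
    and ch :: "('o, 'v, 'h, 'c) bic_choice"
    and w :: 'h
    and A B :: 'o
  assumes "weakly_globular X"
    and "is_bic_choice X ch"
    and "w \<in> Ob (X1 X)"
    and "fob (d0 X) w = A"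
    and "fob (d1 X) w = B"
  shows "quasi_unit (Bic X ch) (fob (gamma X) A) (fob (gamma X) B) w
    \<longleftrightarrow> (\<exists>w_star. companions X A B w w_star)"
proof -
  let ?g = "fob (gamma X)" and ?I = "fob (hs X)"
  have X: "double_category X"
    using assms(1) by (simp add: weakly_globular_def)
  note C0 = double_categoryD(1)[OF X] and C1 = double_categoryD(2)[OF X]
    and F0 = double_categoryD(3)[OF X] and F1 = double_categoryD(4)[OF X]
    and S = double_categoryD(5)[OF X]
  have theta: "is_functor (X0d X) (X0 X) (theta ch)"
    and unit: "nat_iso (X0 X) (X0 X) id_func (comp_func (theta ch) (gamma X)) (theta_unit ch)"
    using assms(2) by (auto simp: is_bic_choice_def pseudo_inverse_def)
  have AB: "A \<in> Ob (X0 X)" "B \<in> Ob (X0 X)"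
    using assms functor_ob[OF F0] functor_ob[OF F1] by auto
  have gA: "?g A \<in> Ob (X0d X)"
    using AB by (simp add: gamma_def X0d_def discrete_def)
  \<comment> \<open>The chosen representative of the component of \<open>A\<close>; its horizontal
    identity is the unit 1-cell.\<close>
  define T where "T = fob (theta ch) (?g A)"
  have T: "T \<in> Ob (X0 X)"
    using functor_ob[OF theta gA] by (simp add: T_def)
  have T_unit: "invertible_arr (X0 X) (theta_unit ch A)" "Dom (X0 X) (theta_unit ch A) = A"
    "Cod (X0 X) (theta_unit ch A) = T"
    using unit AB by (auto simp: nat_iso_def id_func_def comp_func_def T_def)
  have quasi: "quasi_unit (Bic X ch) (?g A) (?g B) w \<longleftrightarrow> ?g B = ?g A \<and>
      (\<exists>\<alpha>. invertible_arr (X1 X) \<alpha> \<and> Dom (X1 X) \<alpha> = w \<and> Cod (X1 X) \<alpha> = ?I T)"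
  proof -
    have "?g T = ?g A"
    proof -
      have "theta_unit ch A \<in> Ar (X0 X)"
        using T_unit(1) by (auto simp: invertible_arr_def inverse_arrows_def)
      from component_eq[OF this] show ?thesis
        using T_unit by (simp add: gamma_def)
    qed
    define H where "H = {f \<in> Ob (X1 X). ?g (fob (d0 X) f) = ?g A \<and> ?g (fob (d1 X) f) = ?g A}"
    have hom: "bhom (Bic X ch) (?g A) (?g A)
        = (X1 X)\<lparr>Ob := H, Ar := {\<alpha> \<in> Ar (X1 X). Dom (X1 X) \<alpha> \<in> H \<and> Cod (X1 X) \<alpha> \<in> H}\<rparr>"
      by (simp add: Bic_def Let_def H_def)
    have H: "?I T \<in> H" "w \<in> H \<longleftrightarrow> ?g B = ?g A"
      using \<open>?g T = ?g A\<close> assms(3-5) functor_ob[OF S T] hs_sides(1,2)[OF X T]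
      by (auto simp: H_def)
    have "invertible_arr (bhom (Bic X ch) (?g A) (?g A)) \<alpha> \<and> Dom (X1 X) \<alpha> = w \<and> Cod (X1 X) \<alpha> = ?I T
        \<longleftrightarrow> invertible_arr (X1 X) \<alpha> \<and> Dom (X1 X) \<alpha> = w \<and> Cod (X1 X) \<alpha> = ?I T"
      if "w \<in> H" for \<alpha>
      using that H(1) invertible_arr_full_subcategory[of "X1 X" \<alpha> H] by (auto simp: hom)
    moreover have "bob (Bic X ch) = Ob (X0d X)" "bunit (Bic X ch) (?g A) = ?I T"
      by (simp_all add: Bic_def T_def)
    moreover have "Ob (bhom (Bic X ch) (?g A) (?g A)) = H"
      "Dom (bhom (Bic X ch) (?g A) (?g A)) = Dom (X1 X)"
      "Cod (bhom (Bic X ch) (?g A) (?g A)) = Cod (X1 X)"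
      by (simp_all add: hom)
    \<comment> \<open>If \<open>w\<close> lies outside \<open>H\<close>, the components of
      \<open>A\<close> and \<open>B\<close> differ and both sides are false.\<close>
    ultimately show ?thesis
      using gA H(2) by (cases "w \<in> H") (simp_all add: quasi_unit_def)
  qed
  show ?thesis
    unfolding quasi
  proof (intro iffI conjI; elim conjE exE)
    fix \<alpha> assume inv: "invertible_arr (X1 X) \<alpha>" and w: "Dom (X1 X) \<alpha> = w"
      and cod: "Cod (X1 X) \<alpha> = ?I T"
    then obtain \<alpha>' where \<alpha>: "inverse_arrows (X1 X) \<alpha> \<alpha>'"
      unfolding invertible_arr_def by blast
    note \<alpha>c = inverse_arrowsD[OF \<alpha>]
    note b = functor_inverse_arrows[OF C1 F1 \<alpha>]
    note bc = inverse_arrowsD[OF b]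
    note sb = functor_inverse_arrows[OF C0 S inverse_arrows_sym[OF b]]
    note sbc = inverse_arrowsD[OF sb]
    have d: "Dom (X0 X) (far (d1 X) \<alpha>) = B" "Cod (X0 X) (far (d1 X) \<alpha>) = T"
      using functor_ar[OF F1 \<alpha>c(1)] assms(5) w cod hs_sides(2)[OF X T] by auto
    \<comment> \<open>The right side of \<alpha> is a vertical isomorphism from \<open>B\<close> to
      \<open>T\<close>. Pasting the identity cell of its inverse below \<alpha> moves the bottom to
      the horizontal identity of \<open>B\<close> and makes the right side trivial.\<close>
    define \<chi> where "\<chi> = Comp (X1 X) (far (hs X) (far (d1 X) \<alpha>')) \<alpha>"
    have c: "Cod (X1 X) \<alpha> = Dom (X1 X) (far (hs X) (far (d1 X) \<alpha>'))"
      using functor_ar[OF S bc(2)] cod bc d by simp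
    have "inverse_arrows (X1 X) \<chi> (Comp (X1 X) \<alpha>' (far (hs X) (far (d1 X) \<alpha>)))"
      unfolding \<chi>_def by (rule inverse_arrows_comp[OF C1 \<alpha> sb c])
    \<comment> \<open>The left side of \<chi> is the companion.\<close>
    moreover have "is_cell X \<chi> w (far (d0 X) \<chi>) (One (X0 X) B) (?I B)"
      using category_comp[OF C1 \<alpha>c(1) sbc(1) c] functor_comp[OF F1 \<alpha>c(1) sbc(1) c]
        hs_sides(4)[OF X bc(2)] functor_ar[OF S bc(2)] bc d w
      by (simp add: is_cell_def \<chi>_def)
    ultimately show "\<exists>w_star. companions X A B w w_star"
      using companions_of_invertible_cell[OF X assms(3-5)] by blast
  next
    fix v assume comp: "companions X A B w v"
    then have v: "v \<in> Ar (X0 X)" "Dom (X0 X) v = A" "Cod (X0 X) v = B"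
      unfolding companions_def by blast+
    show "?g B = ?g A"
      using component_eq[OF v(1)] v by (simp add: gamma_def)
    obtain u where u: "inverse_arrows (X0 X) v u"
      using vertical_arrow_invertible[OF C0 theta unit v(1)] unfolding invertible_arr_def by blast
    obtain t where t: "inverse_arrows (X0 X) (theta_unit ch A) t"
      using T_unit(1) unfolding invertible_arr_def by blast
    obtain \<chi> \<chi>' where \<chi>: "is_cell X \<chi> w v (One (X0 X) B) (?I B)"
      and inv: "inverse_arrows (X1 X) \<chi> \<chi>'"
      using invertible_cell_of_companions[OF X comp u] unfolding invertible_arr_def by blast
    \<comment> \<open>A vertical isomorphism from \<open>B\<close> to \<open>T\<close>: back to
      \<open>A\<close> along \<open>u\<close>, then along the unit component. Its identity cell
      carries the bottom of \<chi> to the unit 1-cell.\<close>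
    let ?k = "Comp (X0 X) (theta_unit ch A) u"
    have uc: "Dom (X0 X) u = B" "Cod (X0 X) u = Dom (X0 X) (theta_unit ch A)"
      using inverse_arrowsD[OF u] v T_unit by auto
    note k = inverse_arrows_comp[OF C0 inverse_arrows_sym[OF u] t uc(2)]
    have kc: "Dom (X0 X) ?k = B" "Cod (X0 X) ?k = T"
      using category_comp[OF C0 inverse_arrowsD(2)[OF u] inverse_arrowsD(1)[OF t] uc(2)] uc T_unit
      by auto
    note sk = functor_inverse_arrows[OF C0 S k] and skc = functor_ar[OF S inverse_arrowsD(1)[OF k]]
    have c: "Cod (X1 X) \<chi> = Dom (X1 X) (far (hs X) ?k)"
      using \<chi> skc kc by (simp add: is_cell_def)
    have "Dom (X1 X) (Comp (X1 X) (far (hs X) ?k) \<chi>) = w"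
      "Cod (X1 X) (Comp (X1 X) (far (hs X) ?k) \<chi>) = ?I T"
      using category_comp[OF C1 inverse_arrowsD(1)[OF inv] skc(1) c] \<chi> skc kc
      by (auto simp: is_cell_def)
    then show "\<exists>\<alpha>. invertible_arr (X1 X) \<alpha> \<and> Dom (X1 X) \<alpha> = w \<and> Cod (X1 X) \<alpha> = ?I T"
      using inverse_arrows_comp[OF C1 inv sk c] unfolding invertible_arr_def by blast
  qed
qed

end
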